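(* If the number of samples is $m_\alpha=r_\alpha$ for all $\alpha\in A$, then the number $M(A,r,r,n)$ of evaluations of the function $u$ required by the empirical algorithm described in the context equals the storage complexity of the tensor format $\mathcal T^A_r(V)$: $$M(A,r,r,n)=\mathrm{storage}(\mathcal T^A_r(V)).$$
   Context: $D=\{1,\dots,d\}$; $u$ is a function on $\mathcal X=\mathcal X_1\times\dots\times\mathcal X_d$, each $\mathcal X_\nu$ equipped with a probability measure $\mu_\nu$; for $\emptyset\neq\alpha\subset D$, $\mathcal X_\alpha=\prod_{\nu\in\alpha}\mathcal X_\nu$, $\alpha^c=D\setminus\alpha$, $\mathcal H_\alpha=\bigotimes_{\nu\in\alpha}\mathcal H_\nu$, with $\mathcal H_\nu$ a Hilbert space of functions on $\mathcal X_\nu$. $T$ is a dimension partition tree over $D$ with root $D$: each node $\alpha$ with $\#\alpha\ge2$ has sons $S(\alpha)\subset T$ forming a partition of $\alpha$; singletons are the leaves, $\mathcal L(T)$ is the set of leaves. $A\subset T\setminus\{D\}$ is an admissible set of active nodes: $T\setminus A\subset\{D\}\cup\mathcal L(T)$. $\mathcal L(A)=A\cap\mathcal L(T)$. $r=(r_\alpha)_{\alpha\in A}$ and $r_D=1$. For leaves $\alpha$, $V_\alpha\subset\mathcal H_\alpha$ has dimension $n_\alpha$ and a unisolvent grid $\Gamma_{V_\alpha}\subset\mathcal X_\alpha$ of $n_\alpha$ points; $n=(n_\alpha)_{\alpha\in\mathcal L(T)}$; $V=\bigotimes_{\alpha\in\mathcal L(T)}V_\alpha$. $\mathcal T^A_r(V)$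 is the set of tensors $v\in V$ with $\mathrm{rank}_\alpha(v)\le r_\alpha$ for all $\alpha\in A$, where $\mathrm{rank}_\alpha(v)$ is the rank of $v$ seen as an order-two tensor in $\mathcal H_\alpha\otimes\mathcal H_{\alpha^c}$. Storage complexity of the hierarchical representation (one coefficient tensor per node of $(A\cup\{D\})\setminus\mathcal L(A)$ and a basis of size $r_\alpha$ per active leaf): $$\mathrm{storage}(\mathcal T^A_r(V))=\sum_{\alpha\in(A\cup\{D\})\setminus\mathcal L(A)}r_\alpha\prod_{\beta\in S(\alpha)\cap A}r_\beta\prod_{\beta\in S(\alpha)\setminus A}n_\beta+\sum_{\alpha\in\mathcal L(A)}r_\alpha n_\alpha .$$ Algorithm: for $\alpha\in\mathcal L(T)\setminus A$, $U_\alpha=V_\alpha$, $\Gamma_{U_\alpha}=\Gamma_{V_\alpha}$. From leaves to root, for each $\alpha\in A$: if $\alpha$ is not a leaf, $V_\alpha=\bigotimes_{\beta\in S(\alpha)}U_\beta$ and $\Gamma_{V_\alpha}=\prod_{\beta\in S(\alpha)}\Gamma_{U_\beta}$; $u_\alpha=(I_{V_\alpha}\otimes id_{\alpha^c})u$, where $I_{V_\alpha}$ is interpolation onto $V_\alpha$ at $\Gamma_{V_\alpha}$; an $r_\alpha$-dimensional subspace $U_\alpha\subset V_\alpha$ is computed by empirical principal component analysis from $m_\alpha$ random samples $u_\alpha(\cdot,x^k_{\alpha^c})$, $1\le k\le m_\alpha$; a grid $\Gamma_{U_\alpha}\subset\Gamma_{V_\alpha}$ of $r_\alpha$ points unisolvent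 for $U_\alpha$ is chosen. Finally $u^\star=I_{V_D}u$ is the interpolation of $u$ in $V_D=\bigotimes_{\beta\in S(D)}U_\beta$ at $\Gamma_{V_D}=\prod_{\beta\in S(D)}\Gamma_{U_\beta}$. Evaluations of $u$ are counted as follows: computing $u_\alpha(\cdot,x^k_{\alpha^c})$ for one sample $x^k_{\alpha^c}$ uses the evaluations of $u$ at all points of $\Gamma_{V_\alpha}\times\{x^k_{\alpha^c}\}$, and computing $u^\star$ uses the evaluations of $u$ on $\Gamma_{V_D}$. $M(A,r,m,n)$, with $m=(m_\alpha)_{\alpha\in A}$, is the resulting total number of evaluations; $M(A,r,r,n)$ is the case $m=r$. *)

theory Defs
  imports "HOL-Probability.Probability" "HOL-Library.Function_Algebras"
begin

text \<open>Real-valued functions as a real vector space with the pointwise operations, so that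
  \<^const>\<open>subspace\<close>, \<^const>\<open>span\<close>, \<^const>\<open>independent\<close> apply to spaces of functions.\<close>

instantiation "fun" :: (type, real_vector) real_vector
begin

definition scaleR_fun :: "real \<Rightarrow> ('a \<Rightarrow> 'b) \<Rightarrow> 'a \<Rightarrow> 'b" where
  "scaleR_fun c f = (\<lambda>x. c *\<^sub>R f x)"

instance
  by standard (simp_all add: scaleR_fun_def plus_fun_def fun_eq_iff scaleR_add_right scaleR_add_left)

end

section \<open>Dimension partition trees and storage complexity\<close>

text \<open>\<open>S \<alpha>\<close> is the set of sons of \<open>\<alpha>\<close>. The condition \<open>S \<alpha> \<noteq> {\<alpha>}\<close> excludes the trivial partition
  (a node is not its own son); the last clause says that every node descends from the root.\<close>

definition dimension_partition_tree ::
  "nat set \<Rightarrow> nat set set \<Rightarrow> (nat set \<Rightarrow> nat set set) \<Rightarrow> bool" where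
  "dimension_partition_tree D T S \<longleftrightarrow>
     finite D \<and> D \<in> T \<and> (\<forall>\<alpha>\<in>T. \<alpha> \<noteq> {} \<and> \<alpha> \<subseteq> D) \<and>
     (\<forall>\<alpha>\<in>T. 2 \<le> card \<alpha> \<longrightarrow> S \<alpha> \<subseteq> T \<and> partition_on \<alpha> (S \<alpha>) \<and> S \<alpha> \<noteq> {\<alpha>}) \<and>
     (\<forall>\<alpha>\<in>T. card \<alpha> = 1 \<longrightarrow> S \<alpha> = {}) \<and>
     (\<forall>\<alpha>\<in>T - {D}. \<exists>\<beta>\<in>T. \<alpha> \<in> S \<beta>)"

definition leaves :: "nat set set \<Rightarrow> nat set set" where
  "leaves T = {\<alpha> \<in> T. card \<alpha> = 1}"

definition admissible :: "nat set \<Rightarrow> nat set set \<Rightarrow> nat set set \<Rightarrow> bool" where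
  "admissible D T A \<longleftrightarrow> A \<subseteq> T - {D} \<and> T - A \<subseteq> {D} \<union> leaves T"

text \<open>The storage complexity of the tree-based tensor format \<open>T\<^sup>A\<^sub>r(V)\<close>. It depends on \<open>V\<close> only through
  the dimensions \<open>n \<alpha>\<close> of the leaf spaces.\<close>

definition storage ::
  "nat set \<Rightarrow> nat set set \<Rightarrow> (nat set \<Rightarrow> nat set set) \<Rightarrow> nat set set
    \<Rightarrow> (nat set \<Rightarrow> nat) \<Rightarrow> (nat set \<Rightarrow> nat) \<Rightarrow> nat" where
  "storage D T S A r n =
     (\<Sum>\<alpha>\<in>(A \<union> {D}) - (A \<inter> leaves T). r \<alpha> * (\<Prod>\<beta>\<in>S \<alpha> \<inter> A. r \<beta>) * (\<Prod>\<beta>\<in>S \<alpha> - A. n \<beta>)) +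
     (\<Sum>\<alpha>\<in>A \<inter> leaves T. r \<alpha> * n \<alpha>)"

section \<open>Spaces of functions\<close>

text \<open>Points of \<open>X\<^sub>\<alpha>\<close> are functions that are undefined outside \<open>\<alpha>\<close>.\<close>

abbreviation dom_of :: "(nat \<Rightarrow> 'a measure) \<Rightarrow> nat set \<Rightarrow> (nat \<Rightarrow> 'a) set" where
  "dom_of \<mu> \<alpha> \<equiv> (\<Pi>\<^sub>E \<nu>\<in>\<alpha>. space (\<mu> \<nu>))"

text \<open>\<^const>\<open>dim\<close> is \<open>0\<close> on infinite-dimensional spaces, so a finite basis is required explicitly.\<close>

definition subspace_of_dim :: "('b \<Rightarrow> real) set \<Rightarrow> nat \<Rightarrow> bool" where
  "subspace_of_dim V k \<longleftrightarrow> (\<exists>B. finite B \<and> independent B \<and> span B = V \<and> card B = k)"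

text \<open>A function on \<open>X\<close> is represented by its extension by \<open>0\<close> to the whole type, so that functions on
  \<open>X\<close> form a subspace and are equal iff they agree on \<open>X\<close>.\<close>

definition hilbert_function_space ::
  "'b set \<Rightarrow> ('b \<Rightarrow> real) set \<Rightarrow> (('b \<Rightarrow> real) \<Rightarrow> ('b \<Rightarrow> real) \<Rightarrow> real) \<Rightarrow> bool" where
  "hilbert_function_space X H ip \<longleftrightarrow>
     subspace H \<and> (\<forall>f\<in>H. \<forall>x. x \<notin> X \<longrightarrow> f x = 0) \<and>
     (\<forall>f\<in>H. \<forall>g\<in>H. ip f g = ip g f) \<and>
     (\<forall>f\<in>H. \<forall>g\<in>H. \<forall>h\<in>H. ip (f + g) h = ip f h + ip g h) \<and>
     (\<forall>c. \<forall>f\<in>H. \<forall>g\<in>H. ip (c *\<^sub>R f) g = c * ip f g) \<and>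
     (\<forall>f\<in>H. f \<noteq> 0 \<longrightarrow> ip f f > 0) \<and>
     (\<forall>F :: nat \<Rightarrow> 'b \<Rightarrow> real.
        (\<forall>i. F i \<in> H) \<and>
        (\<forall>e>0. \<exists>N. \<forall>i\<ge>N. \<forall>j\<ge>N. sqrt (ip (F i - F j) (F i - F j)) < e) \<longrightarrow>
        (\<exists>f\<in>H. (\<lambda>i. sqrt (ip (F i - f) (F i - f))) \<longlonglongrightarrow> 0))"

definition elementary_tensor ::
  "(nat \<Rightarrow> 'a measure) \<Rightarrow> nat set \<Rightarrow> (nat \<Rightarrow> 'a \<Rightarrow> real) \<Rightarrow> (nat \<Rightarrow> 'a) \<Rightarrow> real" where
  "elementary_tensor \<mu> \<alpha> f = (\<lambda>x. if x \<in> dom_of \<mu> \<alpha> then \<Prod>\<nu>\<in>\<alpha>. f \<nu> (x \<nu>) else 0)"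

text \<open>\<open>(K, ipK)\<close> is the Hilbert tensor product of the \<open>(H \<nu>, ip \<nu>)\<close>, \<open>\<nu> \<in> \<alpha>\<close>, realised as a space of
  functions on \<open>X\<^sub>\<alpha>\<close>: the inner product is the canonical one on elementary tensors, and their span (the
  algebraic tensor product) is dense.\<close>

definition hilbert_tensor_product ::
  "(nat \<Rightarrow> 'a measure) \<Rightarrow> nat set \<Rightarrow>
   (nat \<Rightarrow> ('a \<Rightarrow> real) set) \<Rightarrow> (nat \<Rightarrow> ('a \<Rightarrow> real) \<Rightarrow> ('a \<Rightarrow> real) \<Rightarrow> real) \<Rightarrow>
   ((nat \<Rightarrow> 'a) \<Rightarrow> real) set \<Rightarrow> (((nat \<Rightarrow> 'a) \<Rightarrow> real) \<Rightarrow> ((nat \<Rightarrow> 'a) \<Rightarrow> real) \<Rightarrow> real) \<Rightarrow> bool" where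
  "hilbert_tensor_product \<mu> \<alpha> H ip K ipK \<longleftrightarrow>
     hilbert_function_space (dom_of \<mu> \<alpha>) K ipK \<and>
     (\<forall>f. (\<forall>\<nu>\<in>\<alpha>. f \<nu> \<in> H \<nu>) \<longrightarrow> elementary_tensor \<mu> \<alpha> f \<in> K) \<and>
     (\<forall>f g. (\<forall>\<nu>\<in>\<alpha>. f \<nu> \<in> H \<nu> \<and> g \<nu> \<in> H \<nu>) \<longrightarrow>
        ipK (elementary_tensor \<mu> \<alpha> f) (elementary_tensor \<mu> \<alpha> g) = (\<Prod>\<nu>\<in>\<alpha>. ip \<nu> (f \<nu>) (g \<nu>))) \<and>
     (\<forall>h\<in>K. \<forall>e>0. \<exists>g \<in> span {elementary_tensor \<mu> \<alpha> f | f. \<forall>\<nu>\<in>\<alpha>. f \<nu> \<in> H \<nu>}.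
        sqrt (ipK (h - g) (h - g)) < e)"

text \<open>The algebraic tensor product of spaces \<open>U \<beta>\<close> of functions on \<open>X\<^sub>\<beta>\<close>, \<open>\<beta>\<close> in a family \<open>P\<close> of
  disjoint sets, as a space of functions on \<open>X\<^sub>\<alpha>\<close> with \<open>\<alpha> = \<Union>P\<close>.\<close>

definition tensor_space ::
  "(nat \<Rightarrow> 'a measure) \<Rightarrow> nat set set \<Rightarrow> (nat set \<Rightarrow> ((nat \<Rightarrow> 'a) \<Rightarrow> real) set)
    \<Rightarrow> ((nat \<Rightarrow> 'a) \<Rightarrow> real) set" where
  "tensor_space \<mu> P U =
     span {(\<lambda>x. if x \<in> dom_of \<mu> (\<Union>P) then \<Prod>\<beta>\<in>P. f \<beta> (restrict x \<beta>) else 0) | f.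
             \<forall>\<beta>\<in>P. f \<beta> \<in> U \<beta>}"

text \<open>The product of grids \<open>\<Gamma> \<beta> \<subseteq> X\<^sub>\<beta>\<close>, \<open>\<beta> \<in> P\<close>, as a subset of \<open>X\<^sub>\<alpha>\<close> with \<open>\<alpha> = \<Union>P\<close>.\<close>

definition product_grid :: "nat set set \<Rightarrow> (nat set \<Rightarrow> (nat \<Rightarrow> 'a) set) \<Rightarrow> (nat \<Rightarrow> 'a) set" where
  "product_grid P \<Gamma> = {x \<in> extensional (\<Union>P). \<forall>\<beta>\<in>P. restrict x \<beta> \<in> \<Gamma> \<beta>}"

definition unisolvent :: "('b \<Rightarrow> real) set \<Rightarrow> 'b set \<Rightarrow> bool" where
  "unisolvent V \<Gamma> \<longleftrightarrow> finite \<Gamma> \<and> (\<forall>a. \<exists>!v. v \<in> V \<and> (\<forall>x\<in>\<Gamma>. v x = a x))"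

definition interpolation :: "('b \<Rightarrow> real) set \<Rightarrow> 'b set \<Rightarrow> ('b \<Rightarrow> real) \<Rightarrow> 'b \<Rightarrow> real" where
  "interpolation V \<Gamma> f = (THE v. v \<in> V \<and> (\<forall>x\<in>\<Gamma>. v x = f x))"

section \<open>Empirical principal component analysis\<close>

definition orth_projection ::
  "(('b \<Rightarrow> real) \<Rightarrow> ('b \<Rightarrow> real) \<Rightarrow> real) \<Rightarrow> ('b \<Rightarrow> real) set \<Rightarrow> ('b \<Rightarrow> real) \<Rightarrow> 'b \<Rightarrow> real" where
  "orth_projection ip U f = (THE w. w \<in> U \<and> (\<forall>z\<in>U. ip (f - w) z = 0))"

definition empirical_error ::
  "(('b \<Rightarrow> real) \<Rightarrow> ('b \<Rightarrow> real) \<Rightarrow> real) \<Rightarrow> ('b \<Rightarrow> real) set \<Rightarrow> nat \<Rightarrow> (nat \<Rightarrow> 'b \<Rightarrow> real) \<Rightarrow> real" where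
  "empirical_error ip U m f =
     (1 / real m) * (\<Sum>k=1..m. ip (f k - orth_projection ip U (f k)) (f k - orth_projection ip U (f k)))"

definition empirical_principal_subspace ::
  "(('b \<Rightarrow> real) \<Rightarrow> ('b \<Rightarrow> real) \<Rightarrow> real) \<Rightarrow> ('b \<Rightarrow> real) set \<Rightarrow> nat \<Rightarrow> nat \<Rightarrow> (nat \<Rightarrow> 'b \<Rightarrow> real)
    \<Rightarrow> ('b \<Rightarrow> real) set \<Rightarrow> bool" where
  "empirical_principal_subspace ip V r m f U \<longleftrightarrow>
     U \<subseteq> V \<and> subspace_of_dim U r \<and>
     (\<forall>W. W \<subseteq> V \<and> subspace_of_dim W r \<longrightarrow> empirical_error ip U m f \<le> empirical_error ip W m f)"

section \<open>The algorithm and its number of evaluations\<close>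

text \<open>\<open>u\<^sub>\<alpha>(\<cdot>, y) = (I\<^bsub>V\<^sub>\<alpha>\<^esub> \<otimes> id) u (\<cdot>, y)\<close> for \<open>y \<in> X\<^bsub>D - \<alpha>\<^esub>\<close>.\<close>

definition partial_interpolation ::
  "nat set \<Rightarrow> nat set \<Rightarrow> ((nat \<Rightarrow> 'a) \<Rightarrow> real) set \<Rightarrow> (nat \<Rightarrow> 'a) set \<Rightarrow> ((nat \<Rightarrow> 'a) \<Rightarrow> real)
    \<Rightarrow> (nat \<Rightarrow> 'a) \<Rightarrow> (nat \<Rightarrow> 'a) \<Rightarrow> real" where
  "partial_interpolation D \<alpha> V \<Gamma> u y = interpolation V \<Gamma> (\<lambda>x. u (merge \<alpha> (D - \<alpha>) (x, y)))"

text \<open>A run of the algorithm for the realisations \<open>y \<alpha> k\<close> (\<open>\<alpha> \<in> A\<close>, \<open>1 \<le> k \<le> m \<alpha>\<close>) of the random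
  samples. The leaf spaces \<open>V \<alpha>\<close> and leaf grids \<open>\<Gamma>V \<alpha>\<close>, \<open>\<alpha> \<in> leaves T\<close>, are inputs; all other
  values of \<open>V\<close>, \<open>\<Gamma>V\<close>, \<open>U\<close>, \<open>\<Gamma>U\<close> and the output \<open>ustar\<close> are produced by the run. It is a relation
  because neither the principal subspaces nor the subgrids are uniquely determined.\<close>

definition algorithm_run ::
  "nat set \<Rightarrow> nat set set \<Rightarrow> (nat set \<Rightarrow> nat set set) \<Rightarrow> nat set set \<Rightarrow> (nat \<Rightarrow> 'a measure) \<Rightarrow>
   (nat set \<Rightarrow> ((nat \<Rightarrow> 'a) \<Rightarrow> real) \<Rightarrow> ((nat \<Rightarrow> 'a) \<Rightarrow> real) \<Rightarrow> real) \<Rightarrow>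
   ((nat \<Rightarrow> 'a) \<Rightarrow> real) \<Rightarrow> (nat set \<Rightarrow> nat) \<Rightarrow> (nat set \<Rightarrow> nat) \<Rightarrow> (nat set \<Rightarrow> nat \<Rightarrow> nat \<Rightarrow> 'a) \<Rightarrow>
   (nat set \<Rightarrow> ((nat \<Rightarrow> 'a) \<Rightarrow> real) set) \<Rightarrow> (nat set \<Rightarrow> (nat \<Rightarrow> 'a) set) \<Rightarrow>
   (nat set \<Rightarrow> ((nat \<Rightarrow> 'a) \<Rightarrow> real) set) \<Rightarrow> (nat set \<Rightarrow> (nat \<Rightarrow> 'a) set) \<Rightarrow>
   ((nat \<Rightarrow> 'a) \<Rightarrow> real) \<Rightarrow> bool" where
  "algorithm_run D T S A \<mu> ip u r m y V \<Gamma>V U \<Gamma>U ustar \<longleftrightarrow>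
     (\<forall>\<alpha>\<in>leaves T - A. U \<alpha> = V \<alpha> \<and> \<Gamma>U \<alpha> = \<Gamma>V \<alpha>) \<and>
     (\<forall>\<alpha>\<in>(A - leaves T) \<union> {D}. V \<alpha> = tensor_space \<mu> (S \<alpha>) U \<and> \<Gamma>V \<alpha> = product_grid (S \<alpha>) \<Gamma>U) \<and>
     (\<forall>\<alpha>\<in>A.
        empirical_principal_subspace (ip \<alpha>) (V \<alpha>) (r \<alpha>) (m \<alpha>)
          (\<lambda>k. partial_interpolation D \<alpha> (V \<alpha>) (\<Gamma>V \<alpha>) u (y \<alpha> k)) (U \<alpha>) \<and>
        \<Gamma>U \<alpha> \<subseteq> \<Gamma>V \<alpha> \<and> card (\<Gamma>U \<alpha>) = r \<alpha> \<and> unisolvent (U \<alpha>) (\<Gamma>U \<alpha>)) \<and>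
     ustar = interpolation (V D) (\<Gamma>V D) u"

text \<open>The points at which \<open>u\<close> is evaluated to compute \<open>u\<^sub>\<alpha>(\<cdot>, y)\<close>, i.e. \<open>\<Gamma> \<times> {y} \<subseteq> X\<^sub>D\<close>.\<close>

definition sample_points ::
  "nat set \<Rightarrow> nat set \<Rightarrow> (nat \<Rightarrow> 'a) set \<Rightarrow> (nat \<Rightarrow> 'a) \<Rightarrow> (nat \<Rightarrow> 'a) set" where
  "sample_points D \<alpha> \<Gamma> y = (\<lambda>x. merge \<alpha> (D - \<alpha>) (x, y)) ` \<Gamma>"

text \<open>Evaluations are counted separately for each sample of each active node and for the final
  interpolation, even if some evaluation points should happen to coincide.\<close>

definition num_evaluations ::
  "nat set \<Rightarrow> nat set set \<Rightarrow> (nat set \<Rightarrow> nat) \<Rightarrow> (nat set \<Rightarrow> nat \<Rightarrow> nat \<Rightarrow> 'a) \<Rightarrow>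
   (nat set \<Rightarrow> (nat \<Rightarrow> 'a) set) \<Rightarrow> nat" where
  "num_evaluations D A m y \<Gamma>V =
     (\<Sum>\<alpha>\<in>A. \<Sum>k=1..m \<alpha>. card (sample_points D \<alpha> (\<Gamma>V \<alpha>) (y \<alpha> k))) + card (\<Gamma>V D)"

end

theory Submission
  imports Defs
begin

text \<open>Both sides are the same sum over the nodes. At an active node \<open>\<alpha>\<close>, each of the \<open>r \<alpha>\<close> samples
  costs one evaluation per point of \<open>\<Gamma>V \<alpha>\<close>, because the points \<open>(x, y)\<close>, with \<open>x\<close> in the grid and \<open>y\<close>
  fixed, are distinct (\<open>card_sample_points\<close>). So \<open>\<alpha>\<close> contributes \<open>r \<alpha> * card (\<Gamma>V \<alpha>)\<close>, and the final
  interpolation contributes \<open>card (\<Gamma>V D)\<close>, which has the same form since \<open>r D = 1\<close>.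

  On an active leaf the grid has \<open>n \<alpha>\<close> points, which gives the coefficient count \<open>r \<alpha> * n \<alpha>\<close> of
  \<open>r \<alpha>\<close> functions from the \<open>n \<alpha>\<close>-dimensional leaf space. On any other active node and on the root the grid is the product of the grids
  of the sons, so its cardinality is the product of theirs (\<open>card_product_grid\<close>). An active son \<open>\<beta>\<close>
  has a grid of \<open>r \<beta>\<close> points; admissibility forces a son that is not active to be a leaf, whose grid
  has \<open>n \<beta>\<close> points. This gives the size of the coefficient tensor at the node.\<close>

text \<open>A point of the product over a disjoint union is determined by its restrictions to the blocks, and
  these can be prescribed independently. A function that is not extensional on \<open>\<beta>\<close> is never a
  restriction to \<open>\<beta>\<close>, so such an element of a grid would occur in no point of the product.\<close>

lemma card_product_grid:
  assumes fin: "finite P" and disj: "disjoint P"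
    and grids: "\<And>\<beta>. \<beta> \<in> P \<Longrightarrow> \<Gamma> \<beta> \<subseteq> extensional \<beta>"
  shows "card (product_grid P \<Gamma>) = (\<Prod>\<beta>\<in>P. card (\<Gamma> \<beta>))"
proof -
  have block: "\<exists>!\<beta>. \<beta> \<in> P \<and> i \<in> \<beta>" if "i \<in> \<Union>P" for i
    using that disj by (auto simp: disjoint_def)
  define b where "b i = (THE \<beta>. \<beta> \<in> P \<and> i \<in> \<beta>)" for i
  have b: "b i = \<beta>" if "\<beta> \<in> P" "i \<in> \<beta>" for i \<beta>
    unfolding b_def using block[of i] that by (intro the1_equality) auto
  then have in_block: "b i \<in> P" "i \<in> b i" if "i \<in> \<Union>P" for i
    using that by (metis UnionE)+
  have "bij_betw (\<lambda>x. \<lambda>\<beta>\<in>P. restrict x \<beta>) (product_grid P \<Gamma>) (PiE P \<Gamma>)"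
  proof (rule bij_betw_byWitness[where f' = "\<lambda>f. \<lambda>i\<in>\<Union>P. f (b i) i"])
    show "\<forall>x\<in>product_grid P \<Gamma>. (\<lambda>i\<in>\<Union>P. (\<lambda>\<beta>\<in>P. restrict x \<beta>) (b i) i) = x"
    proof (rule ballI, rule ext)
      fix x i assume "x \<in> product_grid P \<Gamma>"
      then have "x i = undefined" if "i \<notin> \<Union>P"
        using that extensional_arb[of x "\<Union>P" i] by (simp add: product_grid_def)
      then show "(\<lambda>i\<in>\<Union>P. (\<lambda>\<beta>\<in>P. restrict x \<beta>) (b i) i) i = x i"
        by (cases "i \<in> \<Union>P") (simp_all del: Union_iff add: in_block)
    qed
    have blockwise: "restrict (\<lambda>i\<in>\<Union>P. f (b i) i) \<beta> = f \<beta>"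
      if "f \<in> PiE P \<Gamma>" "\<beta> \<in> P" for f \<beta>
    proof
      fix i
      have "f \<beta> \<in> extensional \<beta>"
        using PiE_mem[OF that] grids[OF that(2)] by blast
      then have "f \<beta> i = undefined" if "i \<notin> \<beta>"
        using that by (rule extensional_arb)
      then show "restrict (\<lambda>i\<in>\<Union>P. f (b i) i) \<beta> i = f \<beta> i"
        using that(2) b[OF that(2), of i] by (cases "i \<in> \<beta>") auto
    qed
    show "\<forall>f\<in>PiE P \<Gamma>. (\<lambda>\<beta>\<in>P. restrict (\<lambda>i\<in>\<Union>P. f (b i) i) \<beta>) = f"
    proof (rule ballI, rule ext)
      fix f \<beta> assume "f \<in> PiE P \<Gamma>"
      then show "(\<lambda>\<beta>\<in>P. restrict (\<lambda>i\<in>\<Union>P. f (b i) i) \<beta>) \<beta> = f \<beta>"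
        using PiE_arb[of f P \<Gamma> \<beta>]
        by (cases "\<beta> \<in> P") (simp_all only: restrict_apply blockwise if_True if_False not_False_eq_True)
    qed
    show "(\<lambda>x. \<lambda>\<beta>\<in>P. restrict x \<beta>) ` product_grid P \<Gamma> \<subseteq> PiE P \<Gamma>"
      by (auto simp: product_grid_def)
    show "(\<lambda>f. \<lambda>i\<in>\<Union>P. f (b i) i) ` PiE P \<Gamma> \<subseteq> product_grid P \<Gamma>"
    proof (intro image_subsetI)
      fix f assume f: "f \<in> PiE P \<Gamma>"
      have "restrict (\<lambda>i\<in>\<Union>P. f (b i) i) \<beta> \<in> \<Gamma> \<beta>" if "\<beta> \<in> P" for \<beta>
        using that PiE_mem[OF f that] by (simp only: blockwise[OF f that])
      then show "(\<lambda>i\<in>\<Union>P. f (b i) i) \<in> product_grid P \<Gamma>"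
        by (simp add: product_grid_def)
    qed
  qed
  then have "card (product_grid P \<Gamma>) = card (PiE P \<Gamma>)"
    by (rule bij_betw_same_card)
  then show ?thesis
    by (simp add: card_PiE fin)
qed

text \<open>A grid point is recovered from the evaluation point by restriction to \<open>\<alpha>\<close>.\<close>

lemma card_sample_points:
  assumes "\<Gamma> \<subseteq> extensional \<alpha>"
  shows "card (sample_points D \<alpha> \<Gamma> y) = card \<Gamma>"
proof -
  have "restrict (merge \<alpha> (D - \<alpha>) (x, y)) \<alpha> = x" if "x \<in> \<Gamma>" for x
    using that assms by (simp add: extensional_restrict subset_iff)
  then have "inj_on (\<lambda>x. merge \<alpha> (D - \<alpha>) (x, y)) \<Gamma>"
    by (rule inj_on_inverseI[where g = "\<lambda>z. restrict z \<alpha>"])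
  then show ?thesis
    unfolding sample_points_def by (rule card_image)
qed

text \<open>The root is not its own son, and by admissibility it is the only node besides the leaves that can
  be inactive.\<close>

lemma inactive_son_leaf:
  assumes tree: "dimension_partition_tree D T S" and active: "admissible D T A"
    and \<alpha>: "\<alpha> \<in> T" "2 \<le> card \<alpha>" and \<beta>: "\<beta> \<in> S \<alpha>" "\<beta> \<notin> A"
  shows "\<beta> \<in> leaves T"
proof -
  have sons: "S \<alpha> \<subseteq> T" "partition_on \<alpha> (S \<alpha>)" "S \<alpha> \<noteq> {\<alpha>}" and "\<alpha> \<subseteq> D"
    using tree \<alpha> by (auto simp: dimension_partition_tree_def)
  have "\<beta> \<noteq> D"
  proof
    assume "\<beta> = D"
    then have "\<beta> = \<alpha>"
      using sons(2) \<beta>(1) \<open>\<alpha> \<subseteq> D\<close> by (auto dest: partition_onD1)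
    \<comment> \<open>A block that fills \<open>\<alpha>\<close> leaves no room for a second, nonempty block.\<close>
    have "\<gamma> = \<alpha>" if "\<gamma> \<in> S \<alpha>" for \<gamma>
    proof (rule ccontr)
      assume "\<gamma> \<noteq> \<alpha>"
      then have "\<gamma> \<inter> \<alpha> = {}"
        using partition_onD2[OF sons(2)] that \<beta>(1) \<open>\<beta> = \<alpha>\<close> by (auto simp: disjoint_def)
      moreover have "\<gamma> \<subseteq> \<alpha>" "\<gamma> \<noteq> {}"
        using sons(2) that by (auto simp: partition_on_def)
      ultimately show False
        by blast
    qed
    then show False
      using sons(3) \<beta>(1) \<open>\<beta> = \<alpha>\<close> by blast
  qed
  then show ?thesis
    using active sons(1) \<beta> by (auto simp: admissible_def)
qed

theorem corollary6p15:
  fixes d :: nat and D :: "nat set" and T :: "nat set set" and S :: "nat set \<Rightarrow> nat set set"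
    and A :: "nat set set" and r m n :: "nat set \<Rightarrow> nat"
    and \<mu> :: "nat \<Rightarrow> 'a measure"
    and H :: "nat \<Rightarrow> ('a \<Rightarrow> real) set"
    and ip :: "nat \<Rightarrow> ('a \<Rightarrow> real) \<Rightarrow> ('a \<Rightarrow> real) \<Rightarrow> real"
    and HT :: "nat set \<Rightarrow> ((nat \<Rightarrow> 'a) \<Rightarrow> real) set"
    and ipT :: "nat set \<Rightarrow> ((nat \<Rightarrow> 'a) \<Rightarrow> real) \<Rightarrow> ((nat \<Rightarrow> 'a) \<Rightarrow> real) \<Rightarrow> real"
    and u ustar :: "(nat \<Rightarrow> 'a) \<Rightarrow> real"
    and P :: "'w measure" and x :: "nat set \<Rightarrow> nat \<Rightarrow> 'w \<Rightarrow> nat \<Rightarrow> 'a" and \<omega> :: 'w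
    and V U :: "nat set \<Rightarrow> ((nat \<Rightarrow> 'a) \<Rightarrow> real) set"
    and \<Gamma>V \<Gamma>U :: "nat set \<Rightarrow> (nat \<Rightarrow> 'a) set"
  assumes D_def: "D = {1..d}"
    and tree: "dimension_partition_tree D T S"
    and active: "admissible D T A"
    and root_rank: "r D = 1"
    and measures: "\<And>\<nu>. \<nu> \<in> D \<Longrightarrow> prob_space (\<mu> \<nu>)"
    and hilbert: "\<And>\<nu>. \<nu> \<in> D \<Longrightarrow> hilbert_function_space (space (\<mu> \<nu>)) (H \<nu>) (ip \<nu>)"
    and hilbert_tensor: "\<And>\<alpha>. \<alpha> \<noteq> {} \<Longrightarrow> \<alpha> \<subseteq> D \<Longrightarrow>
          hilbert_tensor_product \<mu> \<alpha> H ip (HT \<alpha>) (ipT \<alpha>)"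
    and leaf_spaces: "\<And>\<alpha>. \<alpha> \<in> leaves T \<Longrightarrow> V \<alpha> \<subseteq> HT \<alpha> \<and> subspace_of_dim (V \<alpha>) (n \<alpha>)"
    and leaf_grids: "\<And>\<alpha>. \<alpha> \<in> leaves T \<Longrightarrow>
          \<Gamma>V \<alpha> \<subseteq> dom_of \<mu> \<alpha> \<and> card (\<Gamma>V \<alpha>) = n \<alpha> \<and> unisolvent (V \<alpha>) (\<Gamma>V \<alpha>)"
    and probability: "prob_space P"
    and samples_indep: "\<And>\<alpha>. \<alpha> \<in> A \<Longrightarrow>
          prob_space.indep_vars P (\<lambda>_. PiM (D - \<alpha>) \<mu>) (x \<alpha>) {1..m \<alpha>}"
    and samples_distr: "\<And>\<alpha> k. \<alpha> \<in> A \<Longrightarrow> k \<in> {1..m \<alpha>} \<Longrightarrow>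
          distr P (PiM (D - \<alpha>) \<mu>) (x \<alpha> k) = PiM (D - \<alpha>) \<mu>"
    and outcome: "\<omega> \<in> space P"
    and run: "algorithm_run D T S A \<mu> ipT u r m (\<lambda>\<alpha> k. x \<alpha> k \<omega>) V \<Gamma>V U \<Gamma>U ustar"
    and sample_sizes: "\<And>\<alpha>. \<alpha> \<in> A \<Longrightarrow> m \<alpha> = r \<alpha>"
  shows "num_evaluations D A m (\<lambda>\<alpha> k. x \<alpha> k \<omega>) \<Gamma>V = storage D T S A r n"
proof -
  have fin: "finite D" and root: "D \<in> T"
    and nodes: "\<And>\<alpha>. \<alpha> \<in> T \<Longrightarrow> \<alpha> \<noteq> {} \<and> \<alpha> \<subseteq> D"
    and sons: "\<And>\<alpha>. \<alpha> \<in> T \<Longrightarrow> 2 \<le> card \<alpha> \<Longrightarrow> S \<alpha> \<subseteq> T \<and> partition_on \<alpha> (S \<alpha>)"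
    and leaf_sons: "\<And>\<alpha>. \<alpha> \<in> T \<Longrightarrow> card \<alpha> = 1 \<Longrightarrow> S \<alpha> = {}"
    using tree by (auto simp: dimension_partition_tree_def)
  have A: "A \<subseteq> T" "D \<notin> A"
    using active by (auto simp: admissible_def)
  have finA: "finite A"
    using A(1) nodes fin by (intro finite_subset[of A "Pow D"]) auto
  have inner: "2 \<le> card \<alpha>" if "\<alpha> \<in> T" "\<alpha> \<notin> leaves T" for \<alpha>
  proof -
    have "card \<alpha> \<noteq> 0"
      using nodes[OF that(1)] fin finite_subset by (auto simp: card_eq_0_iff)
    then show ?thesis
      using that by (simp add: leaves_def)
  qed
  have inactive: "\<Gamma>U \<alpha> = \<Gamma>V \<alpha>" if "\<alpha> \<in> leaves T" "\<alpha> \<notin> A" for \<alpha>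
    using run that by (simp add: algorithm_run_def)
  have grid: "\<Gamma>V \<alpha> = product_grid (S \<alpha>) \<Gamma>U" if "\<alpha> \<in> insert D (A - leaves T)" for \<alpha>
    using run that by (auto simp: algorithm_run_def)
  have subgrid: "\<Gamma>U \<alpha> \<subseteq> \<Gamma>V \<alpha>" "card (\<Gamma>U \<alpha>) = r \<alpha>" if "\<alpha> \<in> A" for \<alpha>
    using run that by (auto simp: algorithm_run_def)
  have extV: "\<Gamma>V \<alpha> \<subseteq> extensional \<alpha>" if "\<alpha> \<in> A \<union> leaves T" for \<alpha>
  proof (cases "\<alpha> \<in> leaves T")
    case True
    then show ?thesis
      using leaf_grids[of \<alpha>] by (auto simp: PiE_def)
  next
    case False
    then have "\<alpha> \<in> A" "\<alpha> \<in> T"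
      using that A(1) by auto
    then have "\<Union>(S \<alpha>) = \<alpha>"
      using partition_onD1[of \<alpha> "S \<alpha>"] sons inner False by blast
    then show ?thesis
      using grid[of \<alpha>] \<open>\<alpha> \<in> A\<close> False by (auto simp: product_grid_def)
  qed
  have extU: "\<Gamma>U \<alpha> \<subseteq> extensional \<alpha>" if "\<alpha> \<in> A \<union> leaves T" for \<alpha>
  proof (cases "\<alpha> \<in> A")
    case True
    then show ?thesis
      using subgrid(1) extV[OF that] by blast
  next
    case False
    then show ?thesis
      using inactive extV[OF that] that by simp
  qed
  have card_inner: "card (\<Gamma>V \<alpha>) = (\<Prod>\<beta>\<in>S \<alpha> \<inter> A. r \<beta>) * (\<Prod>\<beta>\<in>S \<alpha> - A. n \<beta>)"
    if \<alpha>: "\<alpha> \<in> insert D (A - leaves T)" for \<alpha>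
  proof (cases "card \<alpha> = 1")
    case True
    \<comment> \<open>This happens only in dimension one, where the root is a leaf: there are no sons, and both sides
      are 1.\<close>
    have "\<alpha> \<in> T"
      using \<alpha> root A(1) by auto
    then show ?thesis
      using card_product_grid[of "{}" \<Gamma>U] grid[OF \<alpha>] leaf_sons True by simp
  next
    case False
    have \<alpha>T: "\<alpha> \<in> T" "2 \<le> card \<alpha>"
      using \<alpha> root A(1) False inner by (auto simp: leaves_def)
    have part: "partition_on \<alpha> (S \<alpha>)"
      using sons \<alpha>T by blast
    have leaf: "\<beta> \<in> leaves T" if "\<beta> \<in> S \<alpha> - A" for \<beta>
      using inactive_son_leaf[OF tree active \<alpha>T] that by blast
    have finS: "finite (S \<alpha>)"
      using finite_elements[OF _ part] finite_subset[OF _ fin] nodes \<alpha>T(1) by blast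
    have "card (\<Gamma>V \<alpha>) = (\<Prod>\<beta>\<in>S \<alpha>. card (\<Gamma>U \<beta>))"
      unfolding grid[OF \<alpha>] using finS partition_onD2[OF part] leaf extU
      by (intro card_product_grid) blast+
    also have "\<dots> = (\<Prod>\<beta>\<in>S \<alpha> \<inter> A. card (\<Gamma>U \<beta>)) * (\<Prod>\<beta>\<in>S \<alpha> - A. card (\<Gamma>U \<beta>))"
      by (rule prod.Int_Diff[OF finS])
    also have "(\<Prod>\<beta>\<in>S \<alpha> \<inter> A. card (\<Gamma>U \<beta>)) = (\<Prod>\<beta>\<in>S \<alpha> \<inter> A. r \<beta>)"
      using subgrid(2) by (intro prod.cong) auto
    also have "(\<Prod>\<beta>\<in>S \<alpha> - A. card (\<Gamma>U \<beta>)) = (\<Prod>\<beta>\<in>S \<alpha> - A. n \<beta>)"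
      using leaf inactive leaf_grids by (intro prod.cong) auto
    finally show ?thesis .
  qed
  have "(\<Sum>\<alpha>\<in>A. \<Sum>k=1..m \<alpha>. card (sample_points D \<alpha> (\<Gamma>V \<alpha>) (x \<alpha> k \<omega>)))
      = (\<Sum>\<alpha>\<in>A. r \<alpha> * card (\<Gamma>V \<alpha>))"
    using extV sample_sizes by (intro sum.cong) (auto simp: card_sample_points)
  also have "\<dots> = (\<Sum>\<alpha>\<in>A \<inter> leaves T. r \<alpha> * card (\<Gamma>V \<alpha>)) + (\<Sum>\<alpha>\<in>A - leaves T. r \<alpha> * card (\<Gamma>V \<alpha>))"
    by (rule sum.Int_Diff[OF finA])
  also have "(\<Sum>\<alpha>\<in>A \<inter> leaves T. r \<alpha> * card (\<Gamma>V \<alpha>)) = (\<Sum>\<alpha>\<in>A \<inter> leaves T. r \<alpha> * n \<alpha>)"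
    using leaf_grids by (intro sum.cong) auto
  finally have "num_evaluations D A m (\<lambda>\<alpha> k. x \<alpha> k \<omega>) \<Gamma>V =
      (\<Sum>\<alpha>\<in>A \<inter> leaves T. r \<alpha> * n \<alpha>) + (\<Sum>\<alpha>\<in>insert D (A - leaves T). r \<alpha> * card (\<Gamma>V \<alpha>))"
    using A(2) finA root_rank by (simp add: num_evaluations_def)
  also have "(\<Sum>\<alpha>\<in>insert D (A - leaves T). r \<alpha> * card (\<Gamma>V \<alpha>)) =
      (\<Sum>\<alpha>\<in>insert D (A - leaves T). r \<alpha> * (\<Prod>\<beta>\<in>S \<alpha> \<inter> A. r \<beta>) * (\<Prod>\<beta>\<in>S \<alpha> - A. n \<beta>))"
    by (intro sum.cong) (simp_all only: card_inner mult.assoc)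
  also have "insert D (A - leaves T) = (A \<union> {D}) - (A \<inter> leaves T)"
    using A(2) by auto
  finally show ?thesis
    by (simp add: storage_def)
qed

end
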